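(* Suppose $0<1/n\ll\theta\ll\epsilon\ll 1$, and $H$ is a $3$-graph on a set $X$ of $n$ vertices that does not contain a Fano plane and has $\delta_2(H)>(1/2-\theta)n$. Then there is a partition $X=A\cup B$ such that at most $\epsilon n^3$ edges of $H$ are contained entirely within $A$ or entirely within $B$.
   Context: Hierarchy convention: "$0<\alpha\ll\beta$" means there is an increasing function $f$ such that the statement holds whenever $0<\alpha<f(\beta)$; chains are read right to left. For a $3$-graph $H$ and $S\subseteq V(H)$, $N_H(S)=\{T\subseteq V(H)\setminus S: S\cup T\in E(H)\}$ and $\delta_2(H)=\min_{|S|=2}|N_H(S)|$. The Fano plane is the $3$-graph on the $7$ nonzero vectors of $\mathbb{F}_2^3$ whose edges are the triples $\{a,b,c\}$ with $a+b=c$; "contains" means as a (not necessarily induced) subgraph. *)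

theory Defs
  imports Complex_Main
begin

definition three_graph :: "'a set \<Rightarrow> 'a set set \<Rightarrow> bool" where
  "three_graph X E \<longleftrightarrow> (\<forall>e\<in>E. e \<subseteq> X \<and> card e = 3)"

definition nbhd :: "'a set \<Rightarrow> 'a set set \<Rightarrow> 'a set \<Rightarrow> 'a set set" where
  "nbhd X E S = {T. T \<subseteq> X - S \<and> S \<union> T \<in> E}"

definition delta2 :: "'a set \<Rightarrow> 'a set set \<Rightarrow> nat" where
  "delta2 X E = Min ((\<lambda>S. card (nbhd X E S)) ` {S. S \<subseteq> X \<and> card S = 2})"

text \<open>The vector space F_2^3, coordinates in bool, addition = componentwise xor.\<close>
type_synonym f2vec = "bool \<times> bool \<times> bool"

definition vadd :: "f2vec \<Rightarrow> f2vec \<Rightarrow> f2vec" where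
  "vadd u v = (case u of (a1,a2,a3) \<Rightarrow> case v of (b1,b2,b3) \<Rightarrow>
      (a1 \<noteq> b1, a2 \<noteq> b2, a3 \<noteq> b3))"

definition fano_vertices :: "f2vec set" where
  "fano_vertices = UNIV - {(False, False, False)}"

definition fano_edges :: "f2vec set set" where
  "fano_edges = {{a, b, c} | a b c. a \<in> fano_vertices \<and> b \<in> fano_vertices
                   \<and> c \<in> fano_vertices \<and> vadd a b = c}"

definition contains_fano :: "'a set \<Rightarrow> 'a set set \<Rightarrow> bool" where
  "contains_fano X E \<longleftrightarrow> (\<exists>f. inj_on f fano_vertices \<and> f ` fano_vertices \<subseteq> X
      \<and> (\<forall>e\<in>fano_edges. f ` e \<in> E))"

end

theory Submission
  imports Defs
begin

text \<open>
  Three disjoint pairs spanning a complete 3-partite 3-graph have codegree neighbourhoods with no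
  common point, since such a point would complete a Fano plane.

  For a 4-set \<open>S\<close> let \<open>O S\<close> be the set of vertices joined to some pair of \<open>S\<close>, and \<open>I S\<close> the set of
  those joined to all pairs of \<open>S\<close>. Among all pairs \<open>(S, T)\<close> of 4-sets for which at least \<open>K\<close>
  vertices are joined to all pairs in \<open>S \<times> T\<close>, choose one maximizing \<open>\<bar>O S \<inter> O T\<bar>\<close>. Within these
  \<open>K\<close> vertices there is, by pigeonhole, another such pair \<open>(S', T')\<close>. As \<open>O S \<inter> O T\<close> is disjoint
  from \<open>O S' \<union> O T'\<close>, maximality gives \<open>\<bar>O S'\<bar> + \<bar>O T'\<bar> \<le> n\<close>; since every codegree is almost \<open>n/2\<close>,
  the codegree neighbourhoods of the six pairs of \<open>S'\<close> almost coincide, so that \<open>\<bar>I S'\<bar>\<close> is almost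
  \<open>n/2\<close>.

  No edge lies inside \<open>A = I S'\<close>: split \<open>S'\<close> into two pairs, and add a pair in \<open>A\<close>. Hence
  every pair in \<open>A\<close> is joined to almost all of \<open>B = V - A\<close>. So \<open>I S''\<close> contains almost all of \<open>B\<close>
  for any 4-set \<open>S'' \<subseteq> A\<close>, and again no edge lies inside \<open>I S''\<close>.
\<close>

section \<open>Pigeonhole arguments\<close>

lemma pigeonhole_fibre:
  assumes "finite A" "finite B" "f ` A \<subseteq> B" "k * card B < card A"
  shows "\<exists>b\<in>B. k < card {a\<in>A. f a = b}"
proof (rule ccontr)
  assume "\<not> ?thesis"
  then have le: "card {a\<in>A. f a = b} \<le> k" if "b \<in> B" for b
    using that by (meson not_le)
  have "card A \<le> card (\<Union>b\<in>B. {a\<in>A. f a = b})"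
    using assms(1-3) by (intro card_mono) auto
  also have "\<dots> \<le> (\<Sum>b\<in>B. card {a\<in>A. f a = b})" by (rule card_UN_le[OF assms(2)])
  also have "\<dots> \<le> (\<Sum>b\<in>B. k)" by (rule sum_mono) (rule le)
  finally show False using assms(4) by (simp add: mult.commute)
qed

text \<open>Double counting. The sets \<open>S p\<close> cover the points of \<open>Q\<close> at
  least 4 times on average, so at least a fraction 1 / |P| of the points are covered 4 times or
  more. Each of these selects a 4-subset of \<open>P\<close>, and there are at most 2 ^ |P| such
  subsets.\<close>

lemma four_sets_large_intersection:
  fixes \<delta> :: real
  assumes "finite P" "finite Q" "\<And>p. p \<in> P \<Longrightarrow> S p \<subseteq> Q"
    and large: "\<And>p. p \<in> P \<Longrightarrow> real (card (S p)) \<ge> \<delta> * card Q"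
    and m: "\<delta> * card P \<ge> 4" and "\<delta> \<le> 1"
  shows "\<exists>P'\<subseteq>P. card P' = 4 \<and>
    real (card {q\<in>Q. \<forall>p\<in>P'. q \<in> S p}) \<ge> card Q / (card P * 2 ^ card P)"
proof -
  define G where "G = {q\<in>Q. card {p\<in>P. q \<in> S p} \<ge> 4}"
  define F where "F = {P'. P' \<subseteq> P \<and> card P' = 4}"
  define D where "D P' = {q\<in>Q. \<forall>p\<in>P'. q \<in> S p}" for P'
  have finG: "finite G" "G \<subseteq> Q" using assms(2) by (auto simp: G_def)
  have finF: "finite F" using assms(1) by (auto simp: F_def)
  have cardF: "card F \<le> 2 ^ card P"
    using card_mono[of "Pow P" F] assms(1) by (auto simp: F_def card_Pow)
  have Ppos: "card P > 0" using m by (cases "card P") auto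
  have "4 * real (card Q) \<le> \<delta> * card P * card Q"
    using m by (intro mult_right_mono) auto
  also have "\<dots> = (\<Sum>p\<in>P. \<delta> * card Q)" by simp
  also have "\<dots> \<le> (\<Sum>p\<in>P. real (card (S p)))" by (rule sum_mono) (rule large)
  also have "\<dots> = real (\<Sum>p\<in>P. card {q\<in>Q. q \<in> S p})"
    unfolding of_nat_sum
  proof (rule sum.cong[OF refl])
    fix p assume "p \<in> P"
    then have "S p = {q\<in>Q. q \<in> S p}" using assms(3) by blast
    then show "real (card (S p)) = real (card {q\<in>Q. q \<in> S p})" by (rule arg_cong)
  qed
  also have "(\<Sum>p\<in>P. card {q\<in>Q. q \<in> S p}) = (\<Sum>q\<in>Q. card {p\<in>P. q \<in> S p})"
    using sum_multicount_gen[OF assms(1,2), of "\<lambda>p q. q \<in> S p"] by simp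
  also have "real \<dots> \<le> (\<Sum>q\<in>Q. 3 + (if q \<in> G then real (card P) else 0))"
    unfolding of_nat_sum
  proof (rule sum_mono)
    fix q assume "q \<in> Q"
    have "card {p\<in>P. q \<in> S p} \<le> card P" using assms(1) by (intro card_mono) auto
    then show "real (card {p\<in>P. q \<in> S p}) \<le> 3 + (if q \<in> G then real (card P) else 0)"
      using \<open>q \<in> Q\<close> by (auto simp: G_def)
  qed
  also have "\<dots> = 3 * card Q + card P * card G"
    using finG assms(2) by (simp add: sum.distrib sum.If_cases Int_absorb1)
  finally have G: "real (card Q) \<le> card P * card G" by simp
  have "G \<subseteq> (\<Union>P'\<in>F. D P')"
  proof
    fix q assume q: "q \<in> G"
    then obtain P' where "P' \<subseteq> {p\<in>P. q \<in> S p}" "card P' = 4"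
      unfolding G_def using obtain_subset_with_card_n by (metis (no_types, lifting) mem_Collect_eq)
    then show "q \<in> (\<Union>P'\<in>F. D P')"
      using q by (auto simp: F_def D_def G_def intro!: bexI[of _ P'])
  qed
  then have "card G \<le> card (\<Union>P'\<in>F. D P')"
    using finF assms(2) by (intro card_mono finite_UN_I) (auto simp: D_def)
  also have "\<dots> \<le> (\<Sum>P'\<in>F. card (D P'))" by (rule card_UN_le[OF finF])
  finally have sumD: "card G \<le> (\<Sum>P'\<in>F. card (D P'))" .
  have "\<exists>P'\<in>F. real (card (D P')) \<ge> card G / 2 ^ card P"
  proof (rule ccontr)
    assume "\<not> ?thesis"
    then have lt: "\<And>P'. P' \<in> F \<Longrightarrow> real (card (D P')) < card G / 2 ^ card P" by force
    \<comment> \<open>This makes \<open>F\<close> nonempty, as the strict comparison of sums below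
      requires.\<close>
    have "card P \<ge> 4"
    proof -
      have "\<delta> * real (card P) \<le> 1 * real (card P)" using \<open>\<delta> \<le> 1\<close> by (intro mult_right_mono) auto
      then show ?thesis using m by linarith
    qed
    then obtain P0 where "P0 \<subseteq> P" "card P0 = 4" by (rule obtain_subset_with_card_n)
    then have "P0 \<in> F" by (simp add: F_def)
    have "real (card G) \<le> (\<Sum>P'\<in>F. real (card (D P')))"
      using sumD by (metis of_nat_le_iff of_nat_sum)
    also have "\<dots> < (\<Sum>P'\<in>F. card G / 2 ^ card P)"
      using finF \<open>P0 \<in> F\<close> lt by (intro sum_strict_mono) auto
    also have "\<dots> = card F * (card G / 2 ^ card P)" by simp
    also have "\<dots> \<le> 2 ^ card P * (card G / 2 ^ card P)"
      using cardF by (intro mult_right_mono) (auto simp flip: of_nat_power)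
    finally show False by simp
  qed
  then obtain P' where P': "P' \<in> F" "real (card (D P')) \<ge> card G / 2 ^ card P" by auto
  have "card Q / (card P * 2 ^ card P) \<le> card G / 2 ^ card P"
    using G Ppos by (simp add: field_simps)
  then have "card Q / (card P * 2 ^ card P) \<le> card (D P')" using P'(2) by linarith
  then show ?thesis using P'(1) unfolding F_def D_def by blast
qed

section \<open>Fano-free 3-graphs\<close>

text \<open>Three lines of the Fano plane pass through the apex \<open>a\<close>; the other four
  take one point from each pair, and here all eight such triples are edges. The seven points are
  distinct because any two of them lie in one of the given edges, which have three elements.\<close>

lemma contains_fano_of_pairs:
  assumes tg: "three_graph V E"
    and cross: "\<And>u v w. u \<in> {x, x'} \<Longrightarrow> v \<in> {y, y'} \<Longrightarrow> w \<in> {z, z'} \<Longrightarrow> {u, v, w} \<in> E"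
    and apex: "{x, x', a} \<in> E" "{y, y', a} \<in> E" "{z, z', a} \<in> E"
  shows "contains_fano V E"
proof -
  have card3: "p \<noteq> q \<and> p \<noteq> r \<and> q \<noteq> r \<and> p \<in> V \<and> q \<in> V \<and> r \<in> V" if "{p, q, r} \<in> E" for p q r
  proof -
    have "card {p, q, r} = 3" "{p, q, r} \<subseteq> V" using tg that by (auto simp: three_graph_def)
    then show ?thesis by (auto simp: card_insert_if split: if_splits)
  qed
  \<comment> \<open>The vector (True, False, False) goes to \<open>a\<close>; otherwise the last two
    coordinates select the pair and the first one its member.\<close>
  define f :: "f2vec \<Rightarrow> 'a" where "f = (\<lambda>(p, q, r).
     if q then (if r then (if p then z' else z) else (if p then x' else x))
     else (if r then (if p then y' else y) else a))"
  have V: "fano_vertices = {(True,False,False), (False,True,False), (True,True,False),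
      (False,False,True), (True,False,True), (False,True,True), (True,True,True)}"
    by (auto simp: fano_vertices_def)
  have e: "{x,y,z} \<in> E" "{x,y,z'} \<in> E" "{x,y',z} \<in> E" "{x,y',z'} \<in> E"
    "{x',y,z} \<in> E" "{x',y,z'} \<in> E" "{x',y',z} \<in> E" "{x',y',z'} \<in> E"
    by (rule cross; simp)+
  note d = e[THEN card3] apex[THEN card3]
  have "inj_on f fano_vertices" using d by (auto simp: V f_def inj_on_def)
  moreover have "f ` fano_vertices \<subseteq> V" using d by (auto simp: V f_def)
  moreover have "f ` e \<in> E" if "e \<in> fano_edges" for e
  proof -
    have "\<exists>p q. e = {p, q, vadd p q} \<and> p \<in> fano_vertices \<and> q \<in> fano_vertices
        \<and> vadd p q \<in> fano_vertices"
      using that unfolding fano_edges_def by blast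
    then obtain p q where pq: "e = {p, q, vadd p q}" "p \<in> fano_vertices" "q \<in> fano_vertices"
      "vadd p q \<in> fano_vertices" by (elim exE conjE)
    have "{f p, f q, f (vadd p q)} \<in> E"
      using pq(2-4) e apex
      unfolding V by (auto simp: vadd_def f_def insert_commute)
    then show ?thesis using pq(1) by simp
  qed
  ultimately show ?thesis unfolding contains_fano_def by blast
qed

section \<open>Common neighbourhoods of pairs in a Fano-free 3-graph\<close>

locale fano_free =
  fixes V :: "'a set" and E :: "'a set set"
  assumes finite_V: "finite V" and three_graph: "three_graph V E"
    and no_fano: "\<not> contains_fano V E"
begin

definition codeg_nbhd :: "'a \<Rightarrow> 'a \<Rightarrow> 'a set" where
  "codeg_nbhd x y = {v\<in>V. {x, y, v} \<in> E}"

text \<open>\<open>joined_some\<close> and \<open>joined_all\<close> are the sets O and I of the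
  introduction.\<close>

definition joined_some :: "'a set \<Rightarrow> 'a set" where
  "joined_some S = {v\<in>V. \<exists>x\<in>S. \<exists>y\<in>S. x \<noteq> y \<and> {x, y, v} \<in> E}"

definition joined_all :: "'a set \<Rightarrow> 'a set" where
  "joined_all S = {v\<in>V. \<forall>x\<in>S. \<forall>y\<in>S. x \<noteq> y \<longrightarrow> {x, y, v} \<in> E}"

text \<open>In a 3-graph this set is empty unless \<open>S\<close> and \<open>T\<close> are
  disjoint, so a positive lower bound on its size forces disjointness.\<close>

definition joined_cross :: "'a set \<Rightarrow> 'a set \<Rightarrow> 'a set" where
  "joined_cross S T = {v\<in>V. \<forall>x\<in>S. \<forall>y\<in>T. {x, y, v} \<in> E}"

lemma finite_sets [simp]:
  "finite (codeg_nbhd x y)" "finite (joined_some S)" "finite (joined_all S)"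
  "finite (joined_cross S T)"
  using finite_V by (auto simp: codeg_nbhd_def joined_some_def joined_all_def joined_cross_def)

lemma subset_V:
  "codeg_nbhd x y \<subseteq> V" "joined_some S \<subseteq> V" "joined_all S \<subseteq> V" "joined_cross S T \<subseteq> V"
  by (auto simp: codeg_nbhd_def joined_some_def joined_all_def joined_cross_def)

text \<open>\<open>nbhd\<close> collects sets, but a set completing a pair to an edge is a
  singleton, so it amounts to a vertex of \<open>codeg_nbhd\<close>.\<close>

lemma card_codeg_nbhd_ge:
  assumes "x \<in> V" "y \<in> V" "x \<noteq> y"
  shows "delta2 V E \<le> card (codeg_nbhd x y)"
proof -
  have "nbhd V E {x, y} \<subseteq> (\<lambda>v. {v}) ` codeg_nbhd x y"
  proof
    fix T assume "T \<in> nbhd V E {x, y}"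
    then have T: "T \<subseteq> V - {x, y}" "{x, y} \<union> T \<in> E" by (auto simp: nbhd_def)
    have "card ({x, y} \<union> T) = 3" using T three_graph by (auto simp: three_graph_def)
    moreover have "card ({x, y} \<union> T) = card {x, y} + card T"
      using T finite_V by (intro card_Un_disjoint) (auto intro: finite_subset)
    ultimately have "card T = 1" using assms by simp
    then obtain v where "T = {v}" by (rule card_1_singletonE)
    then show "T \<in> (\<lambda>v. {v}) ` codeg_nbhd x y"
      using T by (auto simp: codeg_nbhd_def insert_commute)
  qed
  then have "card (nbhd V E {x, y}) \<le> card (codeg_nbhd x y)"
    by (meson card_image_le card_mono finite_imageI finite_sets(1) le_trans)
  moreover have "delta2 V E \<le> card (nbhd V E {x, y})"
    unfolding delta2_def
    by (rule Min_le) (use assms finite_V in \<open>auto intro!: imageI\<close>)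
  ultimately show ?thesis by linarith
qed

text \<open>Otherwise \<open>v\<close> would be the apex of a Fano plane on three pairs taken from
  \<open>S\<close>, \<open>T\<close> and \<open>S'\<close>.\<close>

lemma joined_some_disjoint:
  assumes "S' \<subseteq> joined_cross S T" "v \<in> joined_some S" "v \<in> joined_some T"
  shows "v \<notin> joined_some S'"
proof
  assume "v \<in> joined_some S'"
  then obtain z z' where z: "z \<in> S'" "z' \<in> S'" "{z, z', v} \<in> E" by (auto simp: joined_some_def)
  obtain x x' where x: "x \<in> S" "x' \<in> S" "{x, x', v} \<in> E" using assms by (auto simp: joined_some_def)
  obtain y y' where y: "y \<in> T" "y' \<in> T" "{y, y', v} \<in> E" using assms by (auto simp: joined_some_def)
  have "contains_fano V E"
  proof (rule contains_fano_of_pairs[OF three_graph _ x(3) y(3) z(3)])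
    fix u s w assume "u \<in> {x, x'}" "s \<in> {y, y'}" "w \<in> {z, z'}"
    then have "u \<in> S" "s \<in> T" "w \<in> S'" using x y z by auto
    then show "{u, s, w} \<in> E" using assms(1) by (auto simp: joined_cross_def)
  qed
  then show False using no_fano by simp
qed

text \<open>Two vertices of \<open>e\<close> would form the third pair and the remaining one the
  apex: apart from \<open>e\<close> itself, each triple required joins a pair of \<open>S\<close> to
  a vertex of \<open>e\<close>.\<close>

lemma no_edge_in_joined_all:
  assumes S: "card S = 4" and e: "e \<in> E"
  shows "\<not> e \<subseteq> joined_all S"
proof
  assume sub: "e \<subseteq> joined_all S"
  have "card e = 3" using e three_graph by (auto simp: three_graph_def)
  then obtain u v w where uvw: "e = {u, v, w}" "u \<noteq> v" "u \<noteq> w" "v \<noteq> w"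
    by (metis card_3_iff)
  obtain a b c d where abcd: "S = {a, b, c, d}" "distinct [a, b, c, d]"
  proof -
    obtain xs where "set xs = S" "distinct xs" "length xs = 4"
      using finite_distinct_list[of S] S by (metis card.infinite distinct_card zero_neq_numeral)
    then show thesis using that by (auto simp: numeral_eq_Suc length_Suc_conv)
  qed
  have J: "{s, t, r} \<in> E" if "s \<in> S" "t \<in> S" "s \<noteq> t" "r \<in> e" for s t r
    using sub that by (auto simp: joined_all_def)
  have "contains_fano V E"
  proof (rule contains_fano_of_pairs[OF three_graph, of a b c d u v w])
    fix p q r assume "p \<in> {a, b}" "q \<in> {c, d}" "r \<in> {u, v}"
    then show "{p, q, r} \<in> E" using abcd uvw by (intro J) auto
  qed (use abcd uvw e in \<open>auto intro!: J\<close>)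
  then show False using no_fano by simp
qed

text \<open>Union bound over the ordered pairs in \<open>S\<close>, crudely counted as 16.\<close>

lemma joined_all_deficit:
  assumes S: "card S = 4" "S \<subseteq> V" and M: "finite M" "M \<subseteq> V"
    and defect: "\<And>x y. x \<in> S \<Longrightarrow> y \<in> S \<Longrightarrow> x \<noteq> y \<Longrightarrow> real (card (M - codeg_nbhd x y)) \<le> c"
  shows "real (card (M - joined_all S)) \<le> 16 * c"
proof -
  define P where "P = {(x, y). x \<in> S \<and> y \<in> S \<and> x \<noteq> y}"
  have finS: "finite S" using S finite_V finite_subset by blast
  have P: "P \<subseteq> S \<times> S" by (auto simp: P_def)
  then have finP: "finite P" using finS finite_subset by blast
  have cP: "card P \<le> 16"
    using card_mono[OF _ P] finS S by (simp add: card_cartesian_product)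
  have c0: "c \<ge> 0"
  proof -
    obtain x y where "x \<in> S" "y \<in> S" "x \<noteq> y"
      using S by (metis One_nat_def card_le_Suc0_iff_eq finS numeral_le_one_iff semiring_norm(69))
    then show ?thesis using defect by (meson of_nat_0_le_iff order_trans)
  qed
  have "M - joined_all S \<subseteq> (\<Union>(x, y)\<in>P. M - codeg_nbhd x y)"
    using M by (auto simp: joined_all_def codeg_nbhd_def P_def)
  then have "card (M - joined_all S) \<le> card (\<Union>(x, y)\<in>P. M - codeg_nbhd x y)"
    using finP M by (intro card_mono) auto
  also have "\<dots> \<le> (\<Sum>p\<in>P. card (case p of (x, y) \<Rightarrow> M - codeg_nbhd x y))"
    by (rule card_UN_le[OF finP])
  finally have "real (card (M - joined_all S))
      \<le> (\<Sum>p\<in>P. real (card (case p of (x, y) \<Rightarrow> M - codeg_nbhd x y)))"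
    by (metis of_nat_le_iff of_nat_sum)
  also have "\<dots> \<le> (\<Sum>p\<in>P. c)"
    by (rule sum_mono) (auto simp: P_def intro: defect)
  also have "\<dots> \<le> 16 * c" using cP c0 by (simp add: mult_right_mono)
  finally show ?thesis .
qed

text \<open>
  Fix 12 of the vertices of \<open>Z\<close>. Each further vertex forms pairs with large common neighbourhood
  with some four of the 12, and more than \<open>m\<close> of the further vertices yield the same four.
\<close>

lemma joined_cross_large:
  fixes \<beta> :: real and m :: nat
  assumes codeg: "real (delta2 V E) \<ge> card V / 3"
    and \<beta>: "\<beta> = 1 / (12 * 2 ^ 12)" and m: "\<beta> * m \<ge> 4"
    and Z: "Z \<subseteq> V" "card Z > 12 + m * 2 ^ 12"
  shows "\<exists>S T. S \<subseteq> Z \<and> T \<subseteq> Z \<and> card S = 4 \<and> card T = 4 \<and>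
    real (card (joined_cross S T)) \<ge> card V / (m * 2 ^ m)"
proof -
  have finZ: "finite Z" using Z finite_V finite_subset by blast
  have "12 \<le> card Z" using Z(2) by linarith
  then obtain U where U: "U \<subseteq> Z" "card U = 12" by (rule obtain_subset_with_card_n)
  have finU: "finite U" using U finZ finite_subset by blast
  define W where "W = Z - U"
  have finW: "finite W" using finZ by (simp add: W_def)
  have cardW: "card W > m * 2 ^ 12"
    using Z U finU by (simp add: W_def card_Diff_subset)
  have "\<exists>S\<subseteq>U. card S = 4 \<and> real (card {v\<in>V. \<forall>x\<in>S. v \<in> codeg_nbhd x w}) \<ge> \<beta> * card V"
    if "w \<in> W" for w
  proof -
    \<comment> \<open>The size 12 of \<open>U\<close> is chosen so that density 1/3 gives 12 / 3 =
      4.\<close>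
    have "\<exists>S\<subseteq>U. card S = 4 \<and>
        real (card {v\<in>V. \<forall>x\<in>S. v \<in> codeg_nbhd x w}) \<ge> card V / (card U * 2 ^ card U)"
    proof (rule four_sets_large_intersection[where \<delta> = "1/3"])
      fix x assume "x \<in> U"
      then have "delta2 V E \<le> card (codeg_nbhd x w)"
        using that U Z by (intro card_codeg_nbhd_ge) (auto simp: W_def)
      then show "1 / 3 * real (card V) \<le> real (card (codeg_nbhd x w))" using codeg by linarith
    qed (use finU finite_V subset_V U in auto)
    then show ?thesis using U by (simp add: \<beta>)
  qed
  then have "\<exists>S. \<forall>w\<in>W. S w \<subseteq> U \<and> card (S w) = 4 \<and>
      real (card {v\<in>V. \<forall>x\<in>S w. v \<in> codeg_nbhd x w}) \<ge> \<beta> * card V"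
    by (intro bchoice) blast
  then obtain S where S: "\<And>w. w \<in> W \<Longrightarrow> S w \<subseteq> U \<and> card (S w) = 4 \<and>
      real (card {v\<in>V. \<forall>x\<in>S w. v \<in> codeg_nbhd x w}) \<ge> \<beta> * card V" by blast
  have "\<exists>S0\<in>Pow U. m < card {w\<in>W. S w = S0}"
  proof (rule pigeonhole_fibre[OF finW])
    show "S ` W \<subseteq> Pow U" using S by blast
    show "m * card (Pow U) < card W" using cardW U finU by (simp add: card_Pow)
  qed (use finU in simp)
  then obtain S0 where S0: "S0 \<subseteq> U" "m < card {w\<in>W. S w = S0}" by auto
  obtain W0 where W0: "W0 \<subseteq> {w\<in>W. S w = S0}" "card W0 = m"
    using S0(2) by (rule obtain_subset_with_card_n[OF less_imp_le])
  have finW0: "finite W0" using W0 finW by (auto intro: finite_subset)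
  \<comment> \<open>Second use of the averaging lemma, now indexed by the vertices of
    \<open>W0\<close>, whose sets have density \<beta> in \<open>V\<close>.\<close>
  have "\<exists>T\<subseteq>W0. card T = 4 \<and>
      real (card {v\<in>V. \<forall>w\<in>T. v \<in> {v\<in>V. \<forall>x\<in>S0. v \<in> codeg_nbhd x w}})
        \<ge> card V / (card W0 * 2 ^ card W0)"
  proof (rule four_sets_large_intersection[where \<delta> = \<beta>])
    fix w assume "w \<in> W0"
    then show "\<beta> * card V \<le> card {v\<in>V. \<forall>x\<in>S0. v \<in> codeg_nbhd x w}" using S W0 by blast
  next
    show "4 \<le> \<beta> * card W0" using m W0(2) by simp
    show "\<beta> \<le> 1" by (simp add: \<beta>)
  qed (use finW0 finite_V in auto)
  from this[unfolded W0(2)] obtain T where T: "T \<subseteq> W0" "card T = 4"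
      "real (card {v\<in>V. \<forall>w\<in>T. v \<in> {v\<in>V. \<forall>x\<in>S0. v \<in> codeg_nbhd x w}}) \<ge> card V / (m * 2 ^ m)"
    by (elim exE conjE)
  have "{v\<in>V. \<forall>w\<in>T. v \<in> {v\<in>V. \<forall>x\<in>S0. v \<in> codeg_nbhd x w}} = joined_cross S0 T"
    by (auto simp: joined_cross_def codeg_nbhd_def)
  moreover have "T \<subseteq> Z" using T W0 by (auto simp: W_def)
  \<comment> \<open>The pigeonhole only gave a subset of \<open>U\<close>; its size is read off from
    a vertex of the nonempty fibre over it.\<close>
  moreover have "card S0 = 4"
  proof -
    have "T \<noteq> {}" using T(2) by auto
    then obtain w where "w \<in> W" "S w = S0" using T(1) W0(1) by blast
    then show ?thesis using S by blast
  qed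
  moreover have "S0 \<subseteq> Z" using S0 U by blast
  ultimately show ?thesis using T(2,3) by (intro exI[of _ S0] exI[of _ T]) simp
qed

section \<open>The extremal choice of two 4-sets\<close>

lemma card_joined_some_ge:
  assumes "S \<subseteq> V" "card S = 4"
  shows "delta2 V E \<le> card (joined_some S)"
proof -
  have "\<not> card S \<le> Suc 0" "finite S" using assms finite_V finite_subset by auto
  then obtain x y where xy: "x \<in> S" "y \<in> S" "x \<noteq> y" by (auto simp: card_le_Suc0_iff_eq)
  then have "delta2 V E \<le> card (codeg_nbhd x y)" using assms by (intro card_codeg_nbhd_ge) auto
  also have "\<dots> \<le> card (joined_some S)"
    using xy by (intro card_mono finite_sets) (auto simp: codeg_nbhd_def joined_some_def)
  finally show ?thesis .
qed

text \<open>By maximality, |O S'| + |O T'| = |O S' \<union> O T'| + |O S' \<inter> O T'| is at most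
  |O S' \<union> O T'| + |O S \<inter> O T|, a sum over disjoint sets. The term |O T'| is then
  bounded below by the minimum codegree.\<close>

lemma joined_some_balanced:
  assumes ext: "\<And>Z. Z \<subseteq> V \<Longrightarrow> K \<le> card Z \<Longrightarrow>
      \<exists>S T. S \<subseteq> Z \<and> T \<subseteq> Z \<and> card S = 4 \<and> card T = 4 \<and> K \<le> card (joined_cross S T)"
    and "K \<le> card V"
  shows "\<exists>S\<subseteq>V. card S = 4 \<and> card (joined_some S) + delta2 V E \<le> card V"
proof -
  define good where "good = (\<lambda>(S, T). S \<subseteq> V \<and> T \<subseteq> V \<and> card S = 4 \<and> card T = 4 \<and>
      K \<le> card (joined_cross S T))"
  define \<alpha> where "\<alpha> = (\<lambda>(S, T). card (joined_some S \<inter> joined_some T))"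
  have "\<exists>p. good p" using ext[OF subset_refl \<open>K \<le> card V\<close>] by (auto simp: good_def)
  moreover have "\<forall>p. good p \<longrightarrow> \<alpha> p < Suc (card V)"
    using subset_V(2) finite_V
    by (auto simp: \<alpha>_def less_Suc_eq_le intro!: card_mono dest: subsetD)
  ultimately obtain p where p: "good p" "\<And>q. good q \<Longrightarrow> \<alpha> q \<le> \<alpha> p"
    using ex_has_greatest_nat[of good _ \<alpha>] by blast
  obtain S T where ST: "p = (S, T)" by fastforce
  obtain S' T' where S'T': "S' \<subseteq> joined_cross S T" "T' \<subseteq> joined_cross S T" "card S' = 4"
      "card T' = 4" "K \<le> card (joined_cross S' T')"
    \<comment> \<open>As \<open>p\<close> is good, \<open>joined_cross S T\<close> has at least
      \<open>K\<close> elements, so \<open>ext\<close> applies inside it.\<close>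
    using ext[OF subset_V(4)[of S T]] p ST by (auto simp: good_def)
  have V': "S' \<subseteq> V" "T' \<subseteq> V" using S'T' subset_V by blast+
  have "(joined_some S \<inter> joined_some T) \<inter> (joined_some S' \<union> joined_some T') = {}"
    using joined_some_disjoint S'T' by blast
  then have "card (joined_some S \<inter> joined_some T) + card (joined_some S' \<union> joined_some T')
      = card ((joined_some S \<inter> joined_some T) \<union> (joined_some S' \<union> joined_some T'))"
    by (intro card_Un_disjoint[symmetric]) auto
  also have "\<dots> \<le> card V" using subset_V finite_V by (intro card_mono) blast+
  finally have "card (joined_some S \<inter> joined_some T)
      + card (joined_some S' \<union> joined_some T') \<le> card V" .
  moreover have "card (joined_some S' \<inter> joined_some T') \<le> card (joined_some S \<inter> joined_some T)"
    using p(2)[of "(S', T')"] S'T' V' ST by (simp add: good_def \<alpha>_def)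
  moreover have "card (joined_some S') + card (joined_some T')
      = card (joined_some S' \<union> joined_some T') + card (joined_some S' \<inter> joined_some T')"
    by (intro card_Un_Int) auto
  moreover have "delta2 V E \<le> card (joined_some T')" using card_joined_some_ge V' S'T' by blast
  ultimately have "card (joined_some S') + delta2 V E \<le> card V" by linarith
  then show ?thesis using V' S'T' by blast
qed

section \<open>The partition and the edges inside its parts\<close>

text \<open>Neither \<open>A\<close> nor \<open>joined_all S'\<close> contains an edge, where
  \<open>S'\<close> is a 4-set in \<open>A\<close>. So every edge inside a part lies in
  \<open>B\<close> and meets \<open>R\<close>, the small rest of \<open>B\<close> outside
  \<open>joined_all S'\<close>; at most |R| n^2 edges do so.\<close>

lemma few_edges_inside:
  fixes \<theta> :: real
  assumes codeg: "real (delta2 V E) > (1/2 - \<theta>) * card V" and \<theta>: "0 < \<theta>" "\<theta> < 1/132"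
    and n: "16 \<le> card V"
    and S: "S \<subseteq> V" "card S = 4" "card (joined_some S) + delta2 V E \<le> card V"
  shows "real (card {e\<in>E. e \<subseteq> joined_all S \<or> e \<subseteq> V - joined_all S}) \<le> 544 * \<theta> * card V ^ 3"
proof -
  define n where "n = real (card V)"
  define A where "A = joined_all S"
  have nbhd_ge: "real (card (codeg_nbhd x y)) > (1/2 - \<theta>) * n"
    if "x \<in> V" "y \<in> V" "x \<noteq> y" for x y
    using card_codeg_nbhd_ge[OF that] codeg unfolding n_def by linarith
  have finA: "finite A" "A \<subseteq> V" using subset_V by (auto simp: A_def)
  have some_le: "real (card (joined_some S)) \<le> (1/2 + \<theta>) * n"
    using codeg S(3) unfolding n_def by (simp add: algebra_simps)
  \<comment> \<open>Each pair of \<open>S\<close> misses at most (1/2 + \<theta>) n - (1/2 -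
    \<theta>) n of O S.\<close>
  have "real (card (joined_some S - joined_all S)) \<le> 16 * (2 * \<theta> * n)"
  proof (rule joined_all_deficit)
    fix x y assume xy: "x \<in> S" "y \<in> S" "x \<noteq> y"
    have "codeg_nbhd x y \<subseteq> joined_some S"
      using xy by (auto simp: codeg_nbhd_def joined_some_def)
    then have "card (joined_some S - codeg_nbhd x y) + card (codeg_nbhd x y)
        = card (joined_some S)"
      by (metis card_Diff_subset card_mono finite_sets(1,2) le_add_diff_inverse2)
    moreover have "real (card (codeg_nbhd x y)) > (1/2 - \<theta>) * n"
      using xy S by (intro nbhd_ge) auto
    ultimately show "real (card (joined_some S - codeg_nbhd x y)) \<le> 2 * \<theta> * n"
      using some_le by (simp add: algebra_simps flip: of_nat_add)
  qed (use S subset_V in auto)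
  moreover have "real (card (joined_some S)) > (1/2 - \<theta>) * n"
    using card_joined_some_ge[OF S(1,2)] codeg unfolding n_def by linarith
  moreover have "card (joined_some S) \<le> card (joined_some S - joined_all S) + card A"
  proof -
    have "card (joined_some S) \<le> card ((joined_some S - joined_all S) \<union> A)"
      unfolding A_def by (intro card_mono finite_UnI finite_Diff finite_sets) auto
    then show ?thesis using card_Un_le order_trans by blast
  qed
  \<comment> \<open>The constant is 33 = 16 * 2 + 1.\<close>
  ultimately have A: "real (card A) > (1/2 - 33 * \<theta>) * n"
    by (simp add: algebra_simps)
  \<comment> \<open>The bound 1/132 on \<theta> makes 33 \<theta> less than 1/4, leaving room for a
    4-set in \<open>A\<close>.\<close>
  have "(1/4) * 16 \<le> (1/2 - 33 * \<theta>) * n"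
    using \<theta> n unfolding n_def by (intro mult_mono) auto
  then have "4 \<le> card A" using A by linarith
  then obtain S' where S': "S' \<subseteq> A" "card S' = 4" by (rule obtain_subset_with_card_n)
  have S'V: "S' \<subseteq> V" using S' finA by auto
  define B where "B = V - A"
  define R where "R = B - joined_all S'"
  have B: "real (card B) = n - card A"
    using finA finite_V by (simp add: B_def n_def card_Diff_subset card_mono of_nat_diff)
  \<comment> \<open>Here |B| < (1/2 + 33 \<theta>) n, while a pair of \<open>S'\<close> has all its
    more than (1/2 - \<theta>) n neighbours in \<open>B\<close>; hence 34, and 544 = 16 *
    34.\<close>
  have R: "real (card R) \<le> 16 * (34 * \<theta> * n)"
    unfolding R_def
  proof (rule joined_all_deficit)
    fix x y assume xy: "x \<in> S'" "y \<in> S'" "x \<noteq> y"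
    have "{x, y, v} \<notin> E" if "v \<in> A" for v
      using no_edge_in_joined_all[OF S(2), of "{x, y, v}"] xy S' that by (auto simp: A_def)
    then have "codeg_nbhd x y \<subseteq> B" by (auto simp: codeg_nbhd_def B_def)
    then have "card (B - codeg_nbhd x y) + card (codeg_nbhd x y) = card B"
      by (metis B_def card_Diff_subset card_mono finite_Diff finite_V finite_sets(1)
          le_add_diff_inverse2)
    moreover have "real (card (codeg_nbhd x y)) > (1/2 - \<theta>) * n"
      using xy S'V by (intro nbhd_ge) auto
    ultimately show "real (card (B - codeg_nbhd x y)) \<le> 34 * \<theta> * n"
      using A B by (simp add: algebra_simps flip: of_nat_add)
  qed (use S' S'V finite_V in \<open>auto simp: B_def\<close>)
  have "{e\<in>E. e \<subseteq> A \<or> e \<subseteq> B} \<subseteq> (\<lambda>(x, y, z). {x, y, z}) ` (R \<times> V \<times> V)"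
  proof
    fix e assume e: "e \<in> {e\<in>E. e \<subseteq> A \<or> e \<subseteq> B}"
    then have eB: "e \<subseteq> B" "\<not> e \<subseteq> joined_all S'"
      using no_edge_in_joined_all S S' by (auto simp: A_def)
    then obtain x where x: "x \<in> e" "x \<in> R" by (auto simp: R_def)
    have e3: "e \<subseteq> V" "card e = 3" using e three_graph by (auto simp: three_graph_def)
    then have "card (e - {x}) = 2" using x by (simp add: card_Diff_singleton_if)
    then obtain y z where "e - {x} = {y, z}" by (auto simp: card_2_iff)
    then have "e = {x, y, z}" using x by auto
    then show "e \<in> (\<lambda>(x, y, z). {x, y, z}) ` (R \<times> V \<times> V)"
      using x e3 by (auto intro!: image_eqI[of _ _ "(x, y, z)"])
  qed
  then have "card {e\<in>E. e \<subseteq> A \<or> e \<subseteq> B} \<le> card (R \<times> V \<times> V)"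
    by (rule surj_card_le[rotated]) (auto simp: R_def B_def finite_V)
  also have "real \<dots> = card R * n ^ 2"
    by (simp add: card_cartesian_product n_def power2_eq_square)
  also have "\<dots> \<le> 16 * (34 * \<theta> * n) * n ^ 2" using R by (intro mult_right_mono) auto
  also have "\<dots> = 544 * \<theta> * n ^ 3" by (simp add: power2_eq_square power3_eq_cube)
  finally show ?thesis by (simp add: A_def B_def n_def)
qed

end

section \<open>Choice of the constants\<close>

theorem mainTheorem9:
  shows "\<exists>\<epsilon>0>0. \<forall>\<epsilon>::real. 0 < \<epsilon> \<and> \<epsilon> < \<epsilon>0 \<longrightarrow>
    (\<exists>\<theta>0>0. \<forall>\<theta>::real. 0 < \<theta> \<and> \<theta> < \<theta>0 \<longrightarrow>
      (\<exists>N::nat. \<forall>n\<ge>N. \<forall>(X::'a set) E.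
         finite X \<and> card X = n \<and> three_graph X E \<and> \<not> contains_fano X E
         \<and> real (delta2 X E) > (1/2 - \<theta>) * real n \<longrightarrow>
         (\<exists>A B. A \<union> B = X \<and> A \<inter> B = {} \<and>
            real (card {e\<in>E. e \<subseteq> A \<or> e \<subseteq> B}) \<le> \<epsilon> * real n ^ 3)))"
proof -
  define \<beta> :: real where "\<beta> = 1 / (12 * 2 ^ 12)"
  obtain m :: nat where "4 / \<beta> \<le> real m" using real_arch_simple by blast
  then have m: "\<beta> * m \<ge> 4" by (simp add: \<beta>_def)
  then have m_pos: "m > 0" by (cases m) auto
  \<comment> \<open>13 instead of 12 turns the strict size bound of
    \<open>joined_cross_large\<close> into \<open>K \<le> card Z\<close>.\<close>
  define K :: nat where "K = 13 + m * 2 ^ 12"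
  \<comment> \<open>For n \<ge> \<open>N\<close>, the common set found inside any \<open>K\<close>
    vertices again has at least \<open>K\<close> elements, which is what allows the construction to
    be repeated. \<open>N\<close> depends on neither \<epsilon> nor \<theta>.\<close>
  define N :: nat where "N = K * (m * 2 ^ m)"
  have "K * 1 \<le> K * (m * 2 ^ m)" using m_pos by (intro mult_le_mono) auto
  then have NK: "K \<le> N" by (simp add: N_def)
  have K16: "16 \<le> K" using m_pos by (simp add: K_def)
  have main: "\<exists>A B. A \<union> B = X \<and> A \<inter> B = {} \<and>
      real (card {e\<in>E. e \<subseteq> A \<or> e \<subseteq> B}) \<le> \<epsilon> * real n ^ 3"
    if \<theta>: "0 < \<theta>" "\<theta> < min (1/132) (\<epsilon>/544)" and n: "N \<le> n"
      and X: "finite X" "card X = n" "three_graph X E" "\<not> contains_fano X E"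
      and codeg: "real (delta2 X E) > (1/2 - \<theta>) * real n"
    for \<epsilon> \<theta> :: real and n and X :: "'a set" and E
  proof -
    interpret fano_free X E using X by unfold_locales
    have "1/3 * real n \<le> (1/2 - \<theta>) * real n" using \<theta> by (intro mult_right_mono) auto
    then have codeg3: "real (delta2 X E) \<ge> card X / 3" using codeg X by simp
    have KN: "real K \<le> card X / (m * 2 ^ m)"
    proof -
      have "real K * real (m * 2 ^ m) \<le> card X"
        using n X unfolding N_def by (metis of_nat_le_iff of_nat_mult)
      then show ?thesis using m_pos by (simp add: pos_le_divide_eq)
    qed
    have "\<exists>S\<subseteq>X. card S = 4 \<and> card (joined_some S) + delta2 X E \<le> card X"
    proof (rule joined_some_balanced[of K])
      fix Z assume "Z \<subseteq> X" "K \<le> card Z"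
      then obtain S T where "S \<subseteq> Z" "T \<subseteq> Z" "card S = 4" "card T = 4"
          "real (card (joined_cross S T)) \<ge> card X / (m * 2 ^ m)"
        using joined_cross_large[OF codeg3 \<beta>_def m, of Z] by (auto simp: K_def)
      then show "\<exists>S T. S \<subseteq> Z \<and> T \<subseteq> Z \<and> card S = 4 \<and> card T = 4 \<and> K \<le> card (joined_cross S T)"
        using KN by (meson of_nat_le_iff order_trans)
    qed (use NK n X in simp)
    then obtain S where S: "S \<subseteq> X" "card S = 4" "card (joined_some S) + delta2 X E \<le> card X"
      by blast
    have "real (card {e\<in>E. e \<subseteq> joined_all S \<or> e \<subseteq> X - joined_all S}) \<le> 544 * \<theta> * card X ^ 3"
      using codeg X \<theta> S NK K16 n by (intro few_edges_inside) auto
    also have "\<dots> \<le> \<epsilon> * real n ^ 3" using \<theta> X by (intro mult_mono) auto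
    finally show ?thesis
      using subset_V(3)[of S] by (intro exI[of _ "joined_all S"] exI[of _ "X - joined_all S"]) auto
  qed
  have "\<exists>\<theta>0>0. \<forall>\<theta>::real. 0 < \<theta> \<and> \<theta> < \<theta>0 \<longrightarrow>
      (\<exists>N::nat. \<forall>n\<ge>N. \<forall>(X::'a set) E.
         finite X \<and> card X = n \<and> three_graph X E \<and> \<not> contains_fano X E
         \<and> real (delta2 X E) > (1/2 - \<theta>) * real n \<longrightarrow>
         (\<exists>A B. A \<union> B = X \<and> A \<inter> B = {} \<and>
            real (card {e\<in>E. e \<subseteq> A \<or> e \<subseteq> B}) \<le> \<epsilon> * real n ^ 3))" if "0 < \<epsilon>" for \<epsilon> :: real
    using that main
    by (intro exI[of _ "min (1/132) (\<epsilon>/544)"] conjI allI impI exI[of _ N]) auto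
  \<comment> \<open>The claim holds for every positive \<epsilon>, so the threshold 1 is
    arbitrary.\<close>
  then show ?thesis by (intro exI[of _ 1]) auto
qed

end
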